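(* Let $p>0$ be real and $\mathfrak{S}=\{x\in\mathbb{C}: -1\le \operatorname{Im}(x)\le 0\}$. Let $F_e$ be an even complex function, analytic on an open set (symmetric about $0$) containing $\{x\in\mathbb{C}:|\operatorname{Im}(x)|\le1\}$, such that, uniformly for $x\in\mathfrak{S}$ as $\operatorname{Re}(x)\to\pm\infty$, $F_e(x)+F_e(x+i)=o\!\left(e^{\pi|x|}/|x|\right)$ and $\dfrac{F_e(x)+F_e(x+i)}{\sinh(\pi p(2x+i))}\to0$. Assume that the integrand below has no pole on the real axis (automatic if $p$ is not an integer). Then $$\int_{-\infty}^{\infty}\frac{F_e(x)+F_e(i+x)}{\sinh(\pi p(2x+i))}\,dx=\frac{i}{2p}\sum_{n=\lfloor -p\rfloor}^{-1+\lfloor p\rfloor}(-1)^n\left(F_e\!\left(\frac{i(n+1-p)}{2p}\right)+F_e\!\left(\frac{i(n+1+p)}{2p}\right)\right).$$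
   Context: The integral over the real line is understood as $\lim_{R\to\infty}\int_{-R}^{R}$ (removable singularities of the integrand being filled in); $\lfloor y\rfloor$ is the greatest integer not exceeding $y$. *)

theory Defs
  imports "HOL-Complex_Analysis.Complex_Analysis" "HOL-Library.Landau_Symbols"
begin

definition lower_strip :: "complex set" where
  "lower_strip = {x. -1 \<le> Im x \<and> Im x \<le> 0}"

(* A limit along this filter is a limit for Re x \<rightarrow> \<plusminus>\<infinity>, uniform for x in the strip. *)
definition strip_ends :: "complex filter" where
  "strip_ends = inf (filtercomap (\<lambda>x. \<bar>Re x\<bar>) at_top) (principal lower_strip)"

definition strip_integrand :: "real \<Rightarrow> (complex \<Rightarrow> complex) \<Rightarrow> complex \<Rightarrow> complex" where
  "strip_integrand p F x =
     (F x + F (x + \<i>)) / sinh (of_real (pi * p) * (2 * x + \<i>))"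

(* Integral over the real line as the limit of the integrals over {-R..R}; remove_sings
   fills in the removable singularities of f. *)
definition has_line_integral :: "(complex \<Rightarrow> complex) \<Rightarrow> complex \<Rightarrow> bool" where
  "has_line_integral f I \<longleftrightarrow>
     (\<forall>R::real. (\<lambda>t. remove_sings f (of_real t)) integrable_on {-R..R}) \<and>
     ((\<lambda>R::real. integral {-R..R} (\<lambda>t. remove_sings f (of_real t))) \<longlongrightarrow> I) at_top"

end

theory Submission imports Defs begin

text \<open>
  The whole argument rests on the point reflection \<open>z \<mapsto> - \<i> - z\<close> about \<open>- \<i> / 2\<close>. As \<open>F\<close> is
  even, it exchanges the two summands of \<open>G z = F z + F (z + \<i>)\<close>, and it changes the sign of
  \<open>sinh (\<pi> p (2 z + \<i>))\<close>; so the integrand \<open>f\<close> satisfies \<open>f (- \<i> - z) = - f z\<close>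
  (\<open>f_reflect\<close>). The reflection exchanges opposite sides of the rectangle with corners \<open>\<plusminus>R\<close>,
  \<open>\<plusminus>R - \<i>\<close> and keeps the sense in which its boundary is traversed, while both \<open>f\<close> and \<open>dz\<close>
  change sign. Opposite sides therefore contribute equally to the integral around the
  rectangle, which is twice the difference of the integral over the right-hand side and
  the integral over \<open>[- R, R]\<close> (\<open>rectangle_integral_antisymmetric\<close>).

  Inside the rectangle, \<open>f\<close> has at most simple poles, at the zeros
  \<open>\<i> (n - p) / (2 p)\<close> of the denominator with \<open>\<bar>n\<bar> < p\<close>, and their residues give the sum
  (\<open>residue_node\<close>, \<open>rectangle_residues\<close>). The integral over the right-hand side, of length 1,
  vanishes in the limit since \<open>f\<close> tends to 0 uniformly in the strip
  (\<open>side_integral_tendsto_0\<close>).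

  If \<open>p\<close> is an integer, the zeros for \<open>n = p\<close> and \<open>n = - p\<close> are the points \<open>0\<close> and \<open>- \<i>\<close>, on
  the contour itself. The first is a removable singularity because \<open>f\<close> has no real pole, the
  second by reflection. Moreover \<open>G 0 = 0\<close>, so that the summand that belongs to \<open>n = p\<close> is zero
  (\<open>G_zero\<close>, \<open>residue_sum_reindex\<close>).
\<close>

section \<open>The hyperbolic denominator\<close>

definition sinh_denom :: "real \<Rightarrow> complex \<Rightarrow> complex" where
  "sinh_denom p z = sinh (of_real (pi * p) * (2 * z + \<i>))"

definition node :: "real \<Rightarrow> int \<Rightarrow> complex" where
  "node p n = \<i> * of_real ((of_int n - p) / (2 * p))"

lemma Re_node [simp]: "Re (node p n) = 0"
  and Im_node [simp]: "Im (node p n) = (of_int n - p) / (2 * p)"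
  by (simp_all add: node_def)

lemma inj_node: "p > 0 \<Longrightarrow> inj (node p)"
  by (auto simp: inj_def complex_eq_iff)

lemma node_argument:
  "p > 0 \<Longrightarrow> of_real (pi * p) * (2 * node p n + \<i>) = \<i> * of_real (of_int n * pi)"
  by (simp add: complex_eq_iff field_simps)

lemma sinh_denom_eq_0_iff:
  assumes "p > 0"
  shows "sinh_denom p z = 0 \<longleftrightarrow> (\<exists>n. z = node p n)"
proof -
  have "sinh_denom p z = 0 \<longleftrightarrow> (\<exists>n::int. \<i> * (of_real (pi * p) * (2 * z + \<i>)) = of_real (n * pi))"
    by (simp only: sinh_denom_def sinh_conv_sin) (simp add: sin_eq_0)
  also have "\<dots> \<longleftrightarrow> (\<exists>n::int. z = node p (- n))"
  proof (intro ex_cong1)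
    fix n :: int
    have "- (pi * (p * (2 * Im z + 1))) = pi * of_int n \<longleftrightarrow> - (p * (2 * Im z + 1)) = of_int n"
      by (metis minus_mult_right mult_left_cancel pi_neq_zero)
    then show "\<i> * (of_real (pi * p) * (2 * z + \<i>)) = of_real (n * pi) \<longleftrightarrow> z = node p (- n)"
      using assms by (auto simp: complex_eq_iff field_simps)
  qed
  also have "\<dots> \<longleftrightarrow> (\<exists>n. z = node p n)"
    by (metis minus_minus)
  finally show ?thesis .
qed

lemma sinh_denom_has_derivative:
  assumes "p > 0"
  shows "(sinh_denom p has_field_derivative 2 * of_real (pi * p) * (- 1) powi n) (at (node p n))"
proof -
  have c: "cosh (of_real (pi * p) * (2 * node p n + \<i>)) = (- 1) powi n"
  proof -
    have "cosh (\<i> * of_real (of_int n * pi)) = cos (of_real (of_int n * pi) :: complex)"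
      by (simp add: cosh_conv_cos)
    also have "\<dots> = of_real (cos (of_int n * pi))"
      by (simp only: cos_of_real)
    also have "\<dots> = (- 1) powi n"
      by (simp add: cos_npi_int mult.commute[of _ pi] power_int_minus_left)
    finally show ?thesis
      by (simp only: node_argument[OF assms])
  qed
  show ?thesis
    unfolding sinh_denom_def
    by (rule derivative_eq_intros refl)+ (simp only: c, simp)
qed

lemma sinh_denom_analytic: "sinh_denom p analytic_on A"
  unfolding sinh_denom_def by (intro analytic_intros)

lemma sinh_denom_reflect: "sinh_denom p (- \<i> - z) = - sinh_denom p z"
proof -
  have "of_real (pi * p) * (2 * (- \<i> - z) + \<i>) = - (of_real (pi * p) * (2 * z + \<i>))"
    by (simp add: algebra_simps)
  then show ?thesis
    unfolding sinh_denom_def by (simp only: sinh_minus)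
qed

section \<open>Integrating an antisymmetric function around a rectangle\<close>

text \<open>
  The reflection sends a point \<open>w\<close> moving along one side to \<open>- \<i> - w\<close>, which traverses the
  opposite side in the order in which the contour does. Both the function and the velocity change
  sign, so the two sides have the same integral. The top side runs from right to left, hence
  the minus sign.
\<close>

lemma rectangle_integral_antisymmetric:
  assumes "R > 0"
    and cont: "continuous_on (path_image (rectpath (Complex (- R) (- 1)) (of_real R))) g"
    and anti: "\<And>z. z \<in> path_image (rectpath (Complex (- R) (- 1)) (of_real R)) \<Longrightarrow>
                 g (- \<i> - z) = - g z"
  shows "contour_integral (rectpath (Complex (- R) (- 1)) (of_real R)) g =
           2 * (contour_integral (linepath (Complex R (- 1)) (of_real R)) g -
                integral {- R..R} (\<lambda>t. g (of_real t)))"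
proof -
  define a b c d where abcd: "a = Complex (- R) (- 1)" "b = Complex R (- 1)"
    "c = complex_of_real R" "d = - complex_of_real R"
  have d: "d = Complex (Re a) (Im c)" and b: "b = Complex (Re c) (Im a)"
    by (simp_all add: abcd complex_eq_iff)
  have refl: "- \<i> - a = c" "- \<i> - b = d" "- \<i> - c = a" "- \<i> - d = b"
    by (simp_all add: abcd complex_eq_iff)
  have rect: "rectpath a c = linepath a b +++ linepath b c +++ linepath c d +++ linepath d a"
    by (simp add: rectpath_def Let_def d b)
  have image: "path_image (rectpath a c) =
      closed_segment a b \<union> closed_segment b c \<union> closed_segment c d \<union> closed_segment d a"
    by (simp add: rect path_image_join Un_assoc)
  have cont': "continuous_on (path_image (rectpath a c)) g"
    using cont by (simp add: abcd)
  have side: "continuous_on (closed_segment a b) g" "continuous_on (closed_segment b c) g"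
    "continuous_on (closed_segment c d) g" "continuous_on (closed_segment d a) g"
    by (rule continuous_on_subset[OF cont'], unfold image, blast)+
  have opposite: "contour_integral (linepath u v) g =
      contour_integral (linepath (- \<i> - u) (- \<i> - v)) g"
    if "closed_segment u v \<subseteq> path_image (rectpath a c)" for u v
  proof -
    have "g (linepath (- \<i> - u) (- \<i> - v) x) = - g (linepath u v x)" if "x \<in> {0..1}" for x
    proof -
      have "linepath (- \<i> - u) (- \<i> - v) x = - \<i> - linepath u v x"
        by (simp add: linepath_def scaleR_conv_of_real algebra_simps)
      moreover have "linepath u v x \<in> path_image (rectpath a c)"
        using linepath_in_path[OF that, of u v] \<open>closed_segment u v \<subseteq> _\<close> by blast
      ultimately show ?thesis
        using anti by (simp add: abcd)
    qed
    then show ?thesis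
      unfolding contour_integral_integral
      by (intro integral_cong) (simp add: algebra_simps)
  qed
  have "contour_integral (rectpath a c) g =
      contour_integral (linepath a b) g + contour_integral (linepath b c) g +
      contour_integral (linepath c d) g + contour_integral (linepath d a) g"
    using side by (simp add: rect contour_integrable_continuous_linepath valid_path_join)
  also have "contour_integral (linepath a b) g = contour_integral (linepath c d) g"
    using opposite[of a b] unfolding refl image by blast
  also have "contour_integral (linepath d a) g = contour_integral (linepath b c) g"
    using opposite[of d a] unfolding refl image by blast
  also have "contour_integral (linepath c d) g = - contour_integral (linepath d c) g"
    using side by (intro contour_integral_reverse_linepath)
  also have "contour_integral (linepath d c) g = integral {- R..R} (\<lambda>t. g (of_real t))"
    using assms(1) by (subst contour_integral_linepath_Reals_eq) (auto simp: abcd)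
  finally show ?thesis
    by (simp add: abcd)
qed

section \<open>Symmetry and singularities of the integrand\<close>

locale even_near_strip =
  fixes p :: real and F :: "complex \<Rightarrow> complex" and U :: "complex set"
  assumes p_pos: "p > 0"
    and open_U: "open U"
    and symmetric_U: "\<And>z. z \<in> U \<Longrightarrow> - z \<in> U"
    and strip_U: "{x. \<bar>Im x\<bar> \<le> 1} \<subseteq> U"
    and analytic_F: "F analytic_on U"
    and even_F: "\<And>z. z \<in> U \<Longrightarrow> F (- z) = F z"
    and no_real_pole: "\<And>t::real. \<not> is_pole (strip_integrand p F) (of_real t)"
begin

definition G :: "complex \<Rightarrow> complex" where
  "G z = F z + F (z + \<i>)"

definition V :: "complex set" where
  "V = {z. z \<in> U \<and> z + \<i> \<in> U}"

abbreviation f :: "complex \<Rightarrow> complex" where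
  "f \<equiv> strip_integrand p F"

abbreviation g :: "complex \<Rightarrow> complex" where
  "g \<equiv> remove_sings f"

lemma f_eq: "f = (\<lambda>z. G z / sinh_denom p z)"
  by (simp add: strip_integrand_def G_def sinh_denom_def fun_eq_iff)

lemma open_V: "open V"
proof -
  have "V = U \<inter> (\<lambda>z. z + \<i>) -` U"
    by (auto simp: V_def)
  then show ?thesis
    using open_U by (auto intro!: open_Int open_vimage continuous_intros)
qed

lemma strip_subset_V: "lower_strip \<subseteq> V"
  using strip_U by (auto simp: lower_strip_def V_def)

lemma analytic_G: "G analytic_on V"
proof -
  have "(F \<circ> (\<lambda>z. z + \<i>)) analytic_on V"
    by (rule analytic_on_compose_gen[OF _ analytic_F]) (auto simp: V_def intro!: analytic_intros)
  moreover have "F analytic_on V"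
    by (rule analytic_on_subset[OF analytic_F]) (auto simp: V_def)
  ultimately show ?thesis
    unfolding G_def o_def by (intro analytic_intros)
qed

lemma analytic_f:
  assumes "z \<in> V" "sinh_denom p z \<noteq> 0"
  shows "f analytic_on {z}"
  unfolding f_eq using assms
  by (intro analytic_on_divide sinh_denom_analytic analytic_on_subset[OF analytic_G]) auto

lemma meromorphic_f:
  assumes "z \<in> V"
  shows "f meromorphic_on {z}"
  unfolding f_eq using assms
  by (intro meromorphic_on_divide analytic_on_imp_meromorphic_on sinh_denom_analytic
        analytic_on_subset[OF analytic_G]) auto

lemma f_reflect:
  assumes "z \<in> V"
  shows "f (- \<i> - z) = - f z"
proof -
  have "F (- \<i> - z) = F (z + \<i>)" "F (- \<i> - z + \<i>) = F z"
    using assms even_F[of "z + \<i>"] even_F[of z] by (simp_all add: V_def algebra_simps)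
  then show ?thesis
    by (simp add: f_eq G_def sinh_denom_reflect add.commute)
qed

lemma reflect_V: "z \<in> V \<Longrightarrow> - \<i> - z \<in> V"
  using symmetric_U[of z] symmetric_U[of "z + \<i>"] by (simp add: V_def algebra_simps)

lemma tendsto_f_reflect:
  assumes "z \<in> V" "f \<midarrow>z\<rightarrow> c"
  shows "f \<midarrow>- \<i> - z\<rightarrow> - c"
proof -
  have "filterlim (\<lambda>w. - \<i> - w) (at z) (at (- \<i> - z))"
    by (rule filterlim_atI) (auto intro!: tendsto_eq_intros always_eventually simp: eventually_at_filter algebra_simps)
  then have "((\<lambda>w. - f (- \<i> - w)) \<longlongrightarrow> - c) (at (- \<i> - z))"
    by (intro tendsto_minus filterlim_compose[OF assms(2)])
  moreover have "\<forall>\<^sub>F w in at (- \<i> - z). w \<in> V"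
    using assms(1) by (intro eventually_at_in_open' open_V reflect_V)
  then have "\<forall>\<^sub>F w in at (- \<i> - z). - f (- \<i> - w) = f w"
    by eventually_elim (simp add: f_reflect)
  ultimately show ?thesis
    using tendsto_cong by metis
qed

lemma limit_off_nodes:
  assumes "z \<in> V" "sinh_denom p z \<noteq> 0"
  shows "\<exists>c. f \<midarrow>z\<rightarrow> c"
  using analytic_at_imp_isCont[OF analytic_f[OF assms]] by (auto simp: isCont_def)

text \<open>
  As \<open>f\<close> is meromorphic, having no pole on the real axis means having limits there; the
  reflection carries them to the line \<open>Im z = - 1\<close>.
\<close>

lemma limit_on_boundary:
  assumes "Im z = 0 \<or> Im z = - 1"
  shows "\<exists>c. f \<midarrow>z\<rightarrow> c"
proof -
  have real: "\<exists>c. f \<midarrow>z\<rightarrow> c" if "Im z = 0" for z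
  proof -
    have "z \<in> V"
      using that strip_subset_V by (auto simp: lower_strip_def)
    then have "not_essential f z"
      using meromorphic_f meromorphic_at_iff by blast
    moreover have "\<not> is_pole f z"
      using no_real_pole[of "Re z"] that by (simp add: complex_is_Real_iff)
    ultimately show ?thesis
      by (auto simp: not_essential_def)
  qed
  show ?thesis
  proof (cases "Im z = 0")
    case False
    then have "Im (- \<i> - z) = 0"
      using assms by simp
    then obtain c where "f \<midarrow>- \<i> - z\<rightarrow> c"
      using real by blast
    moreover have "- \<i> - z \<in> V"
      using \<open>Im (- \<i> - z) = 0\<close> strip_subset_V by (auto simp: lower_strip_def)
    ultimately have "f \<midarrow>- \<i> - (- \<i> - z)\<rightarrow> - c"
      by (intro tendsto_f_reflect)
    then show ?thesis by auto
  qed (use real in auto)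
qed

lemma g_analytic:
  assumes "z \<in> V" "\<exists>c. f \<midarrow>z\<rightarrow> c"
  shows "g analytic_on {z}"
  using assms meromorphic_f[of z] by (auto simp: meromorphic_at_iff intro: remove_sings_analytic_at)

lemma g_reflect:
  assumes "z \<in> V" "\<exists>c. f \<midarrow>z\<rightarrow> c"
  shows "g (- \<i> - z) = - g z"
proof -
  obtain c where c: "f \<midarrow>z\<rightarrow> c"
    using assms by blast
  then have "g z = c" "g (- \<i> - z) = - c"
    using tendsto_f_reflect[OF assms(1) c] by auto
  then show ?thesis by simp
qed

text \<open>
  The zero of the denominator is simple, so \<open>f w * (w - z)\<close> converges even when \<open>G\<close> also
  vanishes at \<open>z\<close>; the formula covers that removable case with residue 0.
\<close>

lemma residue_node:
  assumes "node p n \<in> V"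
  shows "residue g (node p n) = (- 1) powi n * G (node p n) / (2 * of_real (pi * p))"
proof -
  let ?z = "node p n"
  have mero: "isolated_singularity_at f ?z"
    using meromorphic_f[OF assms] by (simp add: meromorphic_at_iff)
  then obtain A where A: "open A" "?z \<in> A" "f holomorphic_on (A - {?z})"
    using analytic_imp_holomorphic isolated_singularity_at_iff_analytic_nhd by auto
  have kernel0: "sinh_denom p ?z = 0"
    using sinh_denom_eq_0_iff p_pos by blast
  have G: "(G \<longlongrightarrow> G ?z) (at ?z)"
    using analytic_at_imp_isCont[OF analytic_on_subset[OF analytic_G]] assms
    by (simp add: isCont_def)
  have quot: "((\<lambda>w. sinh_denom p w / (w - ?z)) \<longlongrightarrow> 2 * of_real (pi * p) * (- 1) powi n) (at ?z)"
    using sinh_denom_has_derivative[OF p_pos, of n] by (simp add: has_field_derivative_iff kernel0)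
  have "((\<lambda>w. G w / (sinh_denom p w / (w - ?z))) \<longlongrightarrow> G ?z / (2 * of_real (pi * p) * (- 1) powi n)) (at ?z)"
    using p_pos by (intro tendsto_divide G quot) auto
  then have "residue f ?z = G ?z / (2 * of_real (pi * p) * (- 1) powi n)"
    by (intro residue_simple'[OF A]) (simp add: f_eq)
  also have "\<dots> = (- 1) powi n * G ?z / (2 * of_real (pi * p))"
    by (cases "even n") (auto simp: power_int_minus_left)
  finally show ?thesis
    using mero by simp
qed

text \<open>
  The node is the origin here, and a nonzero numerator over a vanishing denominator would make it
  a real pole.
\<close>

lemma G_zero:
  assumes "of_int n = p"
  shows "G (node p n) = 0"
proof (rule ccontr)
  assume nz: "G (node p n) \<noteq> 0"
  have z: "node p n = 0"
    using assms by (simp add: complex_eq_iff)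
  have "0 \<in> V"
    using strip_subset_V by (auto simp: lower_strip_def)
  then have cont: "isCont G 0"
    by (intro analytic_at_imp_isCont analytic_on_subset[OF analytic_G]) auto
  have der: "(sinh_denom p has_field_derivative 2 * of_real (pi * p) * (- 1) powi n) (at 0)"
    using sinh_denom_has_derivative[OF p_pos, of n] by (simp add: z)
  have k0: "sinh_denom p 0 = 0"
    using sinh_denom_eq_0_iff[OF p_pos] z by metis
  have "filterlim (sinh_denom p) (at 0) (at 0)"
  proof (rule filterlim_atI)
    show "sinh_denom p \<midarrow>0\<rightarrow> 0"
      using DERIV_isCont[OF der] k0 by (simp add: isCont_def)
    have "((\<lambda>w. sinh_denom p w / w) \<longlongrightarrow> 2 * of_real (pi * p) * (- 1) powi n) (at 0)"
      using der by (simp add: has_field_derivative_iff k0)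
    then have "\<forall>\<^sub>F w in at 0. sinh_denom p w / w \<noteq> 0"
      using p_pos by (intro tendsto_imp_eventually_ne) auto
    then show "\<forall>\<^sub>F w in at 0. sinh_denom p w \<noteq> 0"
      by eventually_elim auto
  qed
  then have "is_pole f 0"
    unfolding f_eq using cont nz by (intro is_pole_divide) (simp_all add: z)
  then show False
    using no_real_pole[of 0] by simp
qed

section \<open>The contour integral and its limit\<close>

lemma limit_on_rectangle:
  assumes "z \<in> path_image (rectpath (Complex (- R) (- 1)) (of_real R))" "R > 0"
  shows "z \<in> V" "\<exists>c. f \<midarrow>z\<rightarrow> c"
proof -
  have z: "Re z \<in> {- R, R} \<and> Im z \<in> {- 1..0} \<or> Im z \<in> {- 1, 0}" "z \<in> lower_strip"
    using assms by (auto simp: path_image_rectpath lower_strip_def)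
  show "z \<in> V"
    using z strip_subset_V by auto
  show "\<exists>c. f \<midarrow>z\<rightarrow> c"
  proof (cases "Im z \<in> {- 1, 0}")
    case True
    then show ?thesis using limit_on_boundary by auto
  next
    case False
    then have "Re z \<noteq> 0" using z assms by auto
    then have "sinh_denom p z \<noteq> 0"
      by (auto simp: sinh_denom_eq_0_iff[OF p_pos])
    then show ?thesis
      using \<open>z \<in> V\<close> limit_off_nodes by blast
  qed
qed

lemma rectangle_residues:
  assumes "R > 0"
  shows "contour_integral (rectpath (Complex (- R) (- 1)) (of_real R)) g =
           2 * of_real pi * \<i> * (\<Sum>n | \<bar>of_int n\<bar> < p. residue g (node p n))"
proof -
  let ?\<gamma> = "rectpath (Complex (- R) (- 1)) (of_real R)"
  define N where "N = {n::int. \<bar>of_int n\<bar> < p}"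
  \<comment> \<open>The residue theorem needs an open connected set around the rectangle. The margin \<open>\<delta>\<close> is the
    largest for which the enlarged strip contains only nodes with \<open>\<bar>n\<bar> \<le> p\<close>.\<close>
  define \<delta> where "\<delta> = (of_int \<lfloor>p\<rfloor> + 1 - p) / (2 * p)"
  have \<delta>: "\<delta> > 0"
    using p_pos by (simp add: \<delta>_def)
  define W where "W = V \<inter> {z. Im z > - 1 - \<delta>} \<inter> {z. Im z < \<delta>}"
  define S where "S = connected_component_set W 0"
  have "open W"
    unfolding W_def by (intro open_Int open_V open_halfspace_Im_gt open_halfspace_Im_lt)
  then have open_S: "open S"
    unfolding S_def by (rule open_connected_component)
  have "convex lower_strip"
  proof -
    have "lower_strip = {z. Im z \<ge> - 1} \<inter> {z. Im z \<le> 0}"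
      by (auto simp: lower_strip_def)
    then show ?thesis
      by (metis convex_Int convex_halfspace_Im_ge convex_halfspace_Im_le)
  qed
  then have strip_S: "lower_strip \<subseteq> S"
    unfolding S_def using strip_subset_V \<delta>
    by (intro connected_component_maximal convex_connected) (auto simp: lower_strip_def W_def)
  have SW: "S \<subseteq> W"
    unfolding S_def by (rule connected_component_subset)
  have "N \<subseteq> {- \<lceil>p\<rceil>..\<lceil>p\<rceil>}"
    unfolding N_def by (auto simp: abs_less_iff) linarith+
  then have fin: "finite N"
    by (rule finite_subset) simp
  have an: "g analytic_on {z}" if z: "z \<in> S - node p ` N" for z
  proof -
    have "z \<in> V" using z SW by (auto simp: W_def)
    moreover have "\<exists>c. f \<midarrow>z\<rightarrow> c"
    proof (cases "sinh_denom p z = 0")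
      case True
      then obtain n where n: "z = node p n"
        using sinh_denom_eq_0_iff[OF p_pos] by blast
      have "- 1 - \<delta> < Im z" "Im z < \<delta>"
        using z SW by (auto simp: W_def)
      then have "- 1 < \<delta> + Im z" "Im z < \<delta>"
        by simp_all
      then have "of_int n < (of_int \<lfloor>p\<rfloor> + 1 :: real)" "- (of_int \<lfloor>p\<rfloor> + 1 :: real) < of_int n"
        using p_pos by (simp_all add: n \<delta>_def add_divide_distrib[symmetric] field_simps)
      then have "n < \<lfloor>p\<rfloor> + 1" "- (\<lfloor>p\<rfloor> + 1) < n"
        by linarith+
      then have "n \<le> \<lfloor>p\<rfloor>" "- \<lfloor>p\<rfloor> \<le> n"
        by simp_all
      then have "\<bar>of_int n\<bar> \<le> p"
        by linarith
      moreover have "\<not> \<bar>of_int n\<bar> < p"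
        using z n by (auto simp: N_def)
      ultimately have "of_int n = p \<or> of_int n = - p"
        by linarith
      then have "Im z = 0 \<or> Im z = - 1"
        using p_pos by (auto simp: n field_simps)
      then show ?thesis
        by (rule limit_on_boundary)
    qed (use \<open>z \<in> V\<close> limit_off_nodes in blast)
    ultimately show ?thesis
      by (rule g_analytic)
  qed
  then have hol: "g holomorphic_on S - node p ` N"
    using analytic_on_analytic_at analytic_imp_holomorphic by blast
  have box: "node p n \<in> box (Complex (- R) (- 1)) (of_real R)" if "n \<in> N" for n
    using that p_pos assms by (auto simp: N_def in_box_complex_iff field_simps)
  have cbox: "cbox (Complex (- R) (- 1)) (of_real R) \<subseteq> lower_strip"
    by (auto simp: in_cbox_complex_iff lower_strip_def)
  have "path_image ?\<gamma> = cbox (Complex (- R) (- 1)) (of_real R) - box (Complex (- R) (- 1)) (of_real R)"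
    using assms by (intro path_image_rectpath_cbox_minus_box) auto
  then have image: "path_image ?\<gamma> \<subseteq> S - node p ` N"
    using box cbox strip_S by blast
  have "contour_integral ?\<gamma> g =
      2 * pi * \<i> * (\<Sum>z\<in>node p ` N. winding_number ?\<gamma> z * residue g z)"
  proof (rule Residue_theorem[OF open_S _ _ hol])
    show "connected S" unfolding S_def by simp
    show "\<forall>z. z \<notin> S \<longrightarrow> winding_number ?\<gamma> z = 0"
      using cbox strip_S assms by (auto intro!: winding_number_rectpath_outside)
  qed (use fin image in auto)
  also have "(\<Sum>z\<in>node p ` N. winding_number ?\<gamma> z * residue g z) =
      (\<Sum>n\<in>N. winding_number ?\<gamma> (node p n) * residue g (node p n))"
    using inj_node[OF p_pos] by (subst sum.reindex) (auto intro: inj_on_subset)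
  also have "\<dots> = (\<Sum>n\<in>N. residue g (node p n))"
    by (intro sum.cong refl) (simp add: winding_number_rectpath box)
  finally show ?thesis
    by (simp add: N_def)
qed

text \<open>
  The index of summation is the node index less 1, which accounts for the change of sign. Its range
  \<open>\<lfloor>- p\<rfloor> + 1 \<le> n \<le> \<lfloor>p\<rfloor>\<close> is \<open>- p < n \<le> p\<close>: compared with \<open>\<bar>n\<bar> < p\<close> it has the extra
  term \<open>n = p\<close> when \<open>p\<close> is an integer, where \<open>G_zero\<close> applies.
\<close>

lemma residue_sum_reindex:
  "- (of_real pi * \<i>) * (\<Sum>n | \<bar>of_int n\<bar> < p. residue g (node p n)) =
     \<i> / (2 * of_real p) *
       (\<Sum>n = \<lfloor>- p\<rfloor>..- 1 + \<lfloor>p\<rfloor>. (- 1) powi n *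
          (F (\<i> * of_real ((of_int n + 1 - p) / (2 * p))) +
           F (\<i> * of_real ((of_int n + 1 + p) / (2 * p)))))"
proof -
  define h where "h n = (- 1) powi n * G (node p n)" for n
  have "node p (n + 1) = \<i> * of_real ((of_int n + 1 - p) / (2 * p))"
    "node p (n + 1) + \<i> = \<i> * of_real ((of_int n + 1 + p) / (2 * p))" for n
    using p_pos by (simp_all add: complex_eq_iff field_simps)
  then have summand: "(- 1) powi n *
          (F (\<i> * of_real ((of_int n + 1 - p) / (2 * p))) +
           F (\<i> * of_real ((of_int n + 1 + p) / (2 * p)))) = - h (n + 1)" for n
    unfolding h_def G_def by (simp add: power_int_add)
  have "(\<Sum>n = \<lfloor>- p\<rfloor>..- 1 + \<lfloor>p\<rfloor>. - h (n + 1)) = (\<Sum>n = \<lfloor>- p\<rfloor> + 1..\<lfloor>p\<rfloor>. - h n)"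
    by (rule sum.reindex_bij_witness[of _ "\<lambda>n. n - 1" "\<lambda>n. n + 1"]) auto
  also have "\<dots> = (\<Sum>n | \<bar>of_int n\<bar> < p. - h n)"
  proof (rule sum.mono_neutral_right)
    show "{n. \<bar>of_int n\<bar> < p} \<subseteq> {\<lfloor>- p\<rfloor> + 1..\<lfloor>p\<rfloor>}"
      by (auto simp: abs_less_iff le_floor_iff) linarith+
    show "\<forall>n\<in>{\<lfloor>- p\<rfloor> + 1..\<lfloor>p\<rfloor>} - {n. \<bar>of_int n\<bar> < p}. - h n = 0"
    proof
      fix n assume n: "n \<in> {\<lfloor>- p\<rfloor> + 1..\<lfloor>p\<rfloor>} - {n. \<bar>of_int n\<bar> < p}"
      then have "of_int n = p"
        by auto linarith
      then show "- h n = 0"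
        using G_zero by (simp add: h_def)
    qed
  qed simp
  finally have "(\<Sum>n = \<lfloor>- p\<rfloor>..- 1 + \<lfloor>p\<rfloor>. - h (n + 1)) = - (\<Sum>n | \<bar>of_int n\<bar> < p. h n)"
    by (simp add: sum_negf)
  moreover have "residue g (node p n) = h n / (2 * of_real (pi * p))" if "\<bar>of_int n\<bar> < p" for n
  proof -
    have "node p n \<in> V"
      using that p_pos strip_subset_V by (auto simp: lower_strip_def field_simps)
    then show ?thesis
      by (simp add: residue_node h_def)
  qed
  then have "(\<Sum>n | \<bar>of_int n\<bar> < p. residue g (node p n)) =
      (\<Sum>n | \<bar>of_int n\<bar> < p. h n) / (2 * of_real (pi * p))"
    by (simp add: sum_divide_distrib)
  ultimately show ?thesis
    unfolding summand using p_pos by (simp add: field_simps)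
qed

lemma side_integral_tendsto_0:
  assumes "(f \<longlongrightarrow> 0) strip_ends"
  shows "((\<lambda>R. contour_integral (linepath (Complex R (- 1)) (of_real R)) g) \<longlongrightarrow> 0) at_top"
proof (rule tendstoI)
  fix e :: real assume "e > 0"
  then have "\<forall>\<^sub>F z in strip_ends. norm (f z) < e / 2"
    using tendstoD[OF assms, of "e / 2"] by (simp add: dist_norm)
  then have "\<forall>\<^sub>F z in filtercomap (\<lambda>x. \<bar>Re x\<bar>) at_top. z \<in> lower_strip \<longrightarrow> norm (f z) < e / 2"
    by (simp add: strip_ends_def eventually_inf_principal)
  then obtain R0 where R0: "\<And>z. R0 \<le> \<bar>Re z\<bar> \<Longrightarrow> z \<in> lower_strip \<Longrightarrow> norm (f z) < e / 2"
    by (auto simp: eventually_filtercomap eventually_at_top_linorder)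
  have "norm (contour_integral (linepath (Complex R (- 1)) (of_real R)) g) < e"
    if R: "R \<ge> max R0 1" for R
  proof -
    have seg: "Re z = R \<and> z \<in> lower_strip" if "z \<in> closed_segment (Complex R (- 1)) (of_real R)" for z
      using that by (auto simp: closed_segment_same_Re closed_segment_eq_real_ivl lower_strip_def)
    have fan: "f analytic_on {z}" if "z \<in> closed_segment (Complex R (- 1)) (of_real R)" for z
    proof (rule analytic_f)
      show "z \<in> V" using seg[OF that] strip_subset_V by auto
      show "sinh_denom p z \<noteq> 0"
        using seg[OF that] R by (auto simp: sinh_denom_eq_0_iff[OF p_pos])
    qed
    have "norm (contour_integral (linepath (Complex R (- 1)) (of_real R)) g) \<le>
        e / 2 * norm (complex_of_real R - Complex R (- 1))"
    proof (rule contour_integral_bound_linepath)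
      show "g contour_integrable_on linepath (Complex R (- 1)) (of_real R)"
        using fan by (intro contour_integrable_continuous_linepath holomorphic_on_imp_continuous_on
            analytic_imp_holomorphic remove_sings_analytic_on) (use analytic_on_analytic_at in blast)
      fix z assume z: "z \<in> closed_segment (Complex R (- 1)) (of_real R)"
      then show "norm (g z) \<le> e / 2"
        using R0[of z] seg[OF z] R fan by (simp add: less_imp_le)
    qed (use \<open>e > 0\<close> in simp)
    also have "complex_of_real R - Complex R (- 1) = \<i>"
      by (simp add: complex_eq_iff)
    finally show ?thesis
      using \<open>e > 0\<close> by simp
  qed
  then show "\<forall>\<^sub>F R in at_top. dist (contour_integral (linepath (Complex R (- 1)) (of_real R)) g) 0 < e"
    unfolding eventually_at_top_linorder by (intro exI[of _ "max R0 1"]) simp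
qed

lemma g_integrable: "(\<lambda>t. g (of_real t)) integrable_on {- R..R}" for R :: real
proof -
  have "g analytic_on {z}" if "z \<in> \<real>" for z
    using that strip_subset_V
    by (intro g_analytic limit_on_boundary) (auto simp: complex_is_Real_iff lower_strip_def)
  then have "g analytic_on \<real>"
    using analytic_on_analytic_at by blast
  then have "continuous_on \<real> g"
    by (intro holomorphic_on_imp_continuous_on analytic_imp_holomorphic)
  then have "continuous_on {- R..R} (\<lambda>t. g (of_real t))"
    by (rule continuous_on_compose2) (auto intro!: continuous_intros)
  then show ?thesis
    by (rule integrable_continuous_real)
qed

lemma truncated_integral:
  assumes "R > 0"
  shows "integral {- R..R} (\<lambda>t. g (of_real t)) =
           contour_integral (linepath (Complex R (- 1)) (of_real R)) g -
           of_real pi * \<i> * (\<Sum>n | \<bar>of_int n\<bar> < p. residue g (node p n))"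
proof -
  let ?\<gamma> = "rectpath (Complex (- R) (- 1)) (of_real R)"
  have "g analytic_on {z}" if "z \<in> path_image ?\<gamma>" for z
    by (intro g_analytic limit_on_rectangle[OF that assms])
  then have "g analytic_on path_image ?\<gamma>"
    by (subst analytic_on_analytic_at) blast
  then have "continuous_on (path_image ?\<gamma>) g"
    by (intro holomorphic_on_imp_continuous_on analytic_imp_holomorphic)
  moreover have "g (- \<i> - z) = - g z" if "z \<in> path_image ?\<gamma>" for z
    by (intro g_reflect limit_on_rectangle[OF that assms])
  ultimately have "contour_integral ?\<gamma> g =
      2 * (contour_integral (linepath (Complex R (- 1)) (of_real R)) g -
           integral {- R..R} (\<lambda>t. g (of_real t)))"
    by (rule rectangle_integral_antisymmetric[OF assms])
  then have "2 * (contour_integral (linepath (Complex R (- 1)) (of_real R)) g -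
           integral {- R..R} (\<lambda>t. g (of_real t))) =
      2 * (of_real pi * \<i> * (\<Sum>n | \<bar>of_int n\<bar> < p. residue g (node p n)))"
    unfolding rectangle_residues[OF assms] by (simp only: mult.assoc)
  then have "contour_integral (linepath (Complex R (- 1)) (of_real R)) g -
           integral {- R..R} (\<lambda>t. g (of_real t)) =
      of_real pi * \<i> * (\<Sum>n | \<bar>of_int n\<bar> < p. residue g (node p n))"
    by (simp only: mult_cancel_left) simp
  then show ?thesis
    by (metis diff_diff_eq2 add_diff_cancel_left')
qed

end

theorem mainTheorem14:
  fixes p :: real and F :: "complex \<Rightarrow> complex" and U :: "complex set"
  assumes "p > 0"
    and "open U" and "\<And>z. z \<in> U \<Longrightarrow> - z \<in> U" and "{x. \<bar>Im x\<bar> \<le> 1} \<subseteq> U"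
    and "F analytic_on U" and "\<And>z. z \<in> U \<Longrightarrow> F (- z) = F z"
    and "(\<lambda>x. F x + F (x + \<i>)) \<in> o[strip_ends](\<lambda>x. of_real (exp (pi * norm x) / norm x))"
    and "(strip_integrand p F \<longlongrightarrow> 0) strip_ends"
    and "\<And>t::real. \<not> is_pole (strip_integrand p F) (of_real t)"
  shows "has_line_integral (strip_integrand p F)
           (\<i> / (2 * of_real p) *
             (\<Sum>n = \<lfloor>- p\<rfloor>..- 1 + \<lfloor>p\<rfloor>. (- 1) powi n *
                (F (\<i> * of_real ((of_int n + 1 - p) / (2 * p))) +
                 F (\<i> * of_real ((of_int n + 1 + p) / (2 * p))))))"
proof -
  interpret even_near_strip p F U
    by standard (use assms in auto)
  let ?r = "of_real pi * \<i> * (\<Sum>n | \<bar>of_int n\<bar> < p. residue g (node p n))"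
  have "((\<lambda>R. contour_integral (linepath (Complex R (- 1)) (of_real R)) g - ?r) \<longlongrightarrow> 0 - ?r) at_top"
    by (intro tendsto_diff side_integral_tendsto_0 assms tendsto_const)
  moreover have "\<forall>\<^sub>F R in at_top. contour_integral (linepath (Complex R (- 1)) (of_real R)) g - ?r =
      integral {- R..R} (\<lambda>t. g (of_real t))"
    using eventually_gt_at_top[of 0] by eventually_elim (simp add: truncated_integral)
  ultimately have "((\<lambda>R. integral {- R..R} (\<lambda>t. g (of_real t))) \<longlongrightarrow> 0 - ?r) at_top"
    by (rule Lim_transform_eventually)
  then show ?thesis
    unfolding has_line_integral_def residue_sum_reindex[symmetric]
    using g_integrable by simp
qed

end
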